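(* Let $\mathcal{M}$ be a symmetric Minkowski plane. If there exist two orthogonal circles having exactly one common point, then every pair of distinct circles having exactly one common point is orthogonal, and every pair of orthogonal circles has at most one common point.
   Context: A hyperbola structure is a triple $\mathcal{M}=(\mathcal{P},\Lambda,\Sigma_1\cup\Sigma_2)$, where $\mathcal{P}$ is a nonempty set (points) and $\Lambda,\Sigma_1,\Sigma_2$ are nonempty sets of subsets of $\mathcal{P}$ with $\Sigma_1\cap\Sigma_2=\emptyset$ (elements of $\Lambda$ are circles, elements of $\Sigma_1\cup\Sigma_2$ are generators), such that: (H1) for each point $p$ and $i\in\{1,2\}$ there is exactly one $G\in\Sigma_i$ with $p\in G$, denoted $[p]_i$; (H2) any $A\in\Sigma_1$ and $B\in\Sigma_2$ meet in exactly one point; (H3) every generator meets every circle in exactly one point; (H4) for any three distinct points $a,b,c$ with $[a]_i\neq[b]_i\neq[c]_i\neq[a]_i$ for $i=1,2$ there is exactly one circle containing $a,b,c$; (H5) some circle contains at least three points. For points $p,q$, $pq$ denotes the unique point of $[p]_1\cap[q]_2$. For a circle $K$, the circle symmetry $S_K:\mathcal{P}\to\mathcal{P}$ sends $p$ to the unique point $q$ with $pq\in K$ and $qp\in K$. Two distinct circles $K,L$ are orthogonal ($K\perp L$) if $S_K(p)=p$ for every $p\in L$. Symmetry axiom (S): for any circles $K,L$ and any point $p\in L\setminus K$, if $S_K(p)\in L$ then $K\perp L$. A symmetric Minkowski plane is a hyperbola structure satisfying (S) (it then also satisfies the touching axiom: for every circle $C$, $a\in C$ and $b\notin C\cup[a]_1\cup[a]_2$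 there is exactly one circle $B$ with $b\in B$ and $C\cap B=\{a\}$).
   Formalization: Orthogonality of distinct circles K, L is taken to mean S_K(p) ∈ L for every p ∈ L (i.e. S_K(L) = L), not S_K(p) = p for every p ∈ L; the latter would force L = K, so no circles would be orthogonal and no plane could satisfy (S). *)

theory Defs
  imports Main
begin

definition gen :: "'a set set \<Rightarrow> 'a \<Rightarrow> 'a set" where
  "gen \<Sigma> p = (THE G. G \<in> \<Sigma> \<and> p \<in> G)"

locale hyperbola_structure =
  fixes P :: "'a set"
    and \<Lambda> :: "'a set set"
    and \<Sigma>1 :: "'a set set"
    and \<Sigma>2 :: "'a set set"
  assumes points_nonempty: "P \<noteq> {}"
    and circles_nonempty: "\<Lambda> \<noteq> {}"
    and gens1_nonempty: "\<Sigma>1 \<noteq> {}"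
    and gens2_nonempty: "\<Sigma>2 \<noteq> {}"
    and circles_subset: "\<Lambda> \<subseteq> Pow P"
    and gens1_subset: "\<Sigma>1 \<subseteq> Pow P"
    and gens2_subset: "\<Sigma>2 \<subseteq> Pow P"
    and gens_disjoint: "\<Sigma>1 \<inter> \<Sigma>2 = {}"
    and H1_1: "\<And>p. p \<in> P \<Longrightarrow> \<exists>!G. G \<in> \<Sigma>1 \<and> p \<in> G"
    and H1_2: "\<And>p. p \<in> P \<Longrightarrow> \<exists>!G. G \<in> \<Sigma>2 \<and> p \<in> G"
    and H2: "\<And>A B. A \<in> \<Sigma>1 \<Longrightarrow> B \<in> \<Sigma>2 \<Longrightarrow> \<exists>!x. x \<in> A \<inter> B"
    and H3: "\<And>G K. G \<in> \<Sigma>1 \<union> \<Sigma>2 \<Longrightarrow> K \<in> \<Lambda> \<Longrightarrow> \<exists>!x. x \<in> G \<inter> K"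
    and H4: "\<And>a b c. a \<in> P \<Longrightarrow> b \<in> P \<Longrightarrow> c \<in> P \<Longrightarrow> a \<noteq> b \<Longrightarrow> b \<noteq> c \<Longrightarrow> c \<noteq> a \<Longrightarrow>
      (\<And>\<Sigma>. \<Sigma> \<in> {\<Sigma>1, \<Sigma>2} \<Longrightarrow>
        gen \<Sigma> a \<noteq> gen \<Sigma> b \<and>
        gen \<Sigma> b \<noteq> gen \<Sigma> c \<and>
        gen \<Sigma> c \<noteq> gen \<Sigma> a) \<Longrightarrow>
      \<exists>!K. K \<in> \<Lambda> \<and> a \<in> K \<and> b \<in> K \<and> c \<in> K"
    and H5: "\<exists>K\<in>\<Lambda>. \<exists>a\<in>K. \<exists>b\<in>K. \<exists>c\<in>K. a \<noteq> b \<and> b \<noteq> c \<and> c \<noteq> a"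
begin

abbreviation gen1 :: "'a \<Rightarrow> 'a set" where
  "gen1 \<equiv> gen \<Sigma>1"

abbreviation gen2 :: "'a \<Rightarrow> 'a set" where
  "gen2 \<equiv> gen \<Sigma>2"

definition meet :: "'a \<Rightarrow> 'a \<Rightarrow> 'a" where
  "meet p q = (THE x. x \<in> gen1 p \<inter> gen2 q)"

definition circle_symmetry :: "'a set \<Rightarrow> 'a \<Rightarrow> 'a" where
  "circle_symmetry K p = (THE q. q \<in> P \<and> meet p q \<in> K \<and> meet q p \<in> K)"

text \<open>
  Two distinct circles K and L are orthogonal if the symmetry in K maps L to itself.
  Asking instead that the symmetry in K fixes every point of L would make the relation
  empty: the fixed points of that symmetry are exactly the points of K, and no circle
  contains another one (see \<open>no_pointwise_fixed_circle\<close> below).  As the symmetry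
  is an involution, an inclusion here amounts to equality
  (\<open>orthogonal_iff_image_eq\<close>).
\<close>

definition orthogonal :: "'a set \<Rightarrow> 'a set \<Rightarrow> bool" where
  "orthogonal K L \<longleftrightarrow>
    K \<in> \<Lambda> \<and> L \<in> \<Lambda> \<and> K \<noteq> L \<and> (\<forall>p\<in>L. circle_symmetry K p \<in> L)"

lemma gen1: assumes "p \<in> P" shows "gen1 p \<in> \<Sigma>1" "p \<in> gen1 p"
  using theI'[OF H1_1[OF assms]] by (auto simp: gen_def)

lemma gen2: assumes "p \<in> P" shows "gen2 p \<in> \<Sigma>2" "p \<in> gen2 p"
  using theI'[OF H1_2[OF assms]] by (auto simp: gen_def)

lemma gen1_eqI: "G \<in> \<Sigma>1 \<Longrightarrow> p \<in> G \<Longrightarrow> gen1 p = G"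
  using H1_1[of p] gen1[of p] gens1_subset by blast

lemma gen2_eqI: "G \<in> \<Sigma>2 \<Longrightarrow> p \<in> G \<Longrightarrow> gen2 p = G"
  using H1_2[of p] gen2[of p] gens2_subset by blast

lemma meet_in: assumes "p \<in> P" "q \<in> P" shows "meet p q \<in> gen1 p" "meet p q \<in> gen2 q"
  using theI'[OF H2[OF gen1(1)[OF assms(1)] gen2(1)[OF assms(2)]]] by (auto simp: meet_def)

lemma meet_eqI: "p \<in> P \<Longrightarrow> q \<in> P \<Longrightarrow> x \<in> gen1 p \<Longrightarrow> x \<in> gen2 q \<Longrightarrow> meet p q = x"
  using H2[OF gen1(1) gen2(1), of p q] meet_in[of p q] by blast

lemma circle_symmetry_ex1:
  assumes K: "K \<in> \<Lambda>" and p: "p \<in> P"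
  shows "\<exists>!q. q \<in> P \<and> meet p q \<in> K \<and> meet q p \<in> K"
proof -
  obtain k where k: "k \<in> gen1 p" "k \<in> K" and uk: "\<And>x. x \<in> gen1 p \<Longrightarrow> x \<in> K \<Longrightarrow> x = k"
    using H3[of "gen1 p" K] K gen1[OF p] by blast
  obtain l where l: "l \<in> gen2 p" "l \<in> K" and ul: "\<And>x. x \<in> gen2 p \<Longrightarrow> x \<in> K \<Longrightarrow> x = l"
    using H3[of "gen2 p" K] K gen2[OF p] by blast
  have P: "k \<in> P" "l \<in> P" using k l K circles_subset by auto
  define q where "q = meet l k"
  have q: "q \<in> gen1 l" "q \<in> gen2 k" using meet_in P by (auto simp: q_def)
  then have qP: "q \<in> P" using gen1(1)[OF P(2)] gens1_subset by blast
  have g: "gen1 q = gen1 l" "gen2 q = gen2 k"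
    using q P by (auto intro!: gen1_eqI gen2_eqI gen1(1) gen2(1))
  have "meet p q = k" using meet_eqI[OF p qP] k g gen2(2)[OF P(1)] by simp
  moreover have "meet q p = l" using meet_eqI[OF qP p] l g gen1(2)[OF P(2)] by simp
  moreover have "r = q" if r: "r \<in> P" "meet p r \<in> K" "meet r p \<in> K" for r
  proof -
    have "meet p r = k" "meet r p = l" using r meet_in p uk ul by auto
    then have "k \<in> gen2 r" "l \<in> gen1 r" using meet_in r p by metis+
    then have "gen2 k = gen2 r" "gen1 l = gen1 r"
      using r by (auto intro!: gen1_eqI gen2_eqI gen1(1) gen2(1))
    then have "r \<in> gen1 l" "r \<in> gen2 k" using gen1 gen2 r by auto
    then show ?thesis using meet_eqI[OF P(2,1)] by (simp add: q_def)
  qed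
  ultimately show ?thesis using qP k l by (metis)
qed

lemma circle_symmetry:
  assumes "K \<in> \<Lambda>" "p \<in> P"
  shows "circle_symmetry K p \<in> P" "meet p (circle_symmetry K p) \<in> K"
    "meet (circle_symmetry K p) p \<in> K"
  using theI'[OF circle_symmetry_ex1[OF assms]] by (auto simp: circle_symmetry_def)

lemma circle_symmetry_eqI:
  "K \<in> \<Lambda> \<Longrightarrow> p \<in> P \<Longrightarrow> q \<in> P \<Longrightarrow> meet p q \<in> K \<Longrightarrow> meet q p \<in> K \<Longrightarrow> circle_symmetry K p = q"
  using circle_symmetry_ex1[of K p] circle_symmetry[of K p] by blast

lemma circle_symmetry_invol:
  "K \<in> \<Lambda> \<Longrightarrow> p \<in> P \<Longrightarrow> circle_symmetry K (circle_symmetry K p) = p"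
  using circle_symmetry by (intro circle_symmetry_eqI)

lemma circle_symmetry_fixed_iff:
  assumes "K \<in> \<Lambda>" "p \<in> P"
  shows "circle_symmetry K p = p \<longleftrightarrow> p \<in> K"
proof -
  have "meet p p = p" using meet_eqI[of p p p] gen1 gen2 assms by auto
  then show ?thesis using circle_symmetry[OF assms] circle_symmetry_eqI[OF assms assms(2)] by metis
qed

lemma circle_subset_eq:
  assumes "K \<in> \<Lambda>" "L \<in> \<Lambda>" "L \<subseteq> K"
  shows "K = L"
proof -
  have "x \<in> L" if x: "x \<in> K" for x
  proof -
    have xP: "x \<in> P" using x assms circles_subset by auto
    obtain y where y: "y \<in> gen1 x" "y \<in> L" using H3[of "gen1 x" L] gen1[OF xP] assms by blast
    then have "y = x" using H3[of "gen1 x" K] gen1[OF xP] assms x by blast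
    with y show ?thesis by simp
  qed
  then show ?thesis using assms by blast
qed

lemma no_pointwise_fixed_circle:
  assumes "K \<in> \<Lambda>" "L \<in> \<Lambda>" "K \<noteq> L"
  shows "\<not> (\<forall>p\<in>L. circle_symmetry K p = p)"
  using circle_subset_eq[OF assms(1,2)] circle_symmetry_fixed_iff[OF assms(1)] assms
    circles_subset by blast

lemma orthogonal_iff_image_eq:
  "orthogonal K L \<longleftrightarrow> K \<in> \<Lambda> \<and> L \<in> \<Lambda> \<and> K \<noteq> L \<and> circle_symmetry K ` L = L"
proof -
  have "p \<in> circle_symmetry K ` L"
    if "K \<in> \<Lambda>" "L \<in> \<Lambda>" "\<forall>p\<in>L. circle_symmetry K p \<in> L" "p \<in> L" for p
    using that circle_symmetry_invol[of K p] circles_subset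
    by (metis Pow_iff imageI subsetD)
  then show ?thesis unfolding orthogonal_def by blast
qed

end

locale symmetric_minkowski_plane = hyperbola_structure +
  assumes symmetry_axiom:
    "\<And>K L p. K \<in> \<Lambda> \<Longrightarrow> L \<in> \<Lambda> \<Longrightarrow> p \<in> L - K \<Longrightarrow> circle_symmetry K p \<in> L \<Longrightarrow> orthogonal K L"

end

theory Submission
  imports Defs "HOL-Combinatorics.Permutations"
begin

text \<open>
  Fix a circle $E$.  A circle is the graph of a permutation of $E$, so the circles form a sharply
  3-transitive set $F$ of permutations containing the identity, and $K \perp L$ means that
  $f^{-1} g$ is an involution.  The symmetry axiom says that $f^{-1} g$ is an involution as soon as
  it swaps some pair of points.  From this alone $F$ is closed under $f g^{-1} f$, that is, circle
  symmetries are automorphisms; in particular involutions in $F$ may be conjugated by involutions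
  in $F$.  Such conjugations carry any involution fixing a point to any other one fixing it, so
  they all have the same number of fixed points: one touching orthogonal pair forbids secant
  orthogonal circles to the same circle.  This property passes from a circle to any circle
  orthogonal to it, and any two circles have a common orthogonal circle (or are orthogonal or
  equal), hence it holds everywhere.  Finally, if $g$ touches the identity at $p$ without being an
  involution, then an involution in $F$ that inverts $g$ and fixes a point moved by $g$ also
  fixes $p$, which is excluded.
\<close>

section \<open>Orthogonality in sharply 3-transitive sets of permutations\<close>

text \<open>For bijections this says that \<open>inv f \<circ> g\<close> is its own inverse.
  Avoiding \<open>inv\<close> makes symmetry and invariance under left composition with an injection
  immediate.\<close>

definition orth :: "('a \<Rightarrow> 'a) \<Rightarrow> ('a \<Rightarrow> 'a) \<Rightarrow> bool" where
  "orth f g \<longleftrightarrow> (\<forall>s t. f s = g t \<longrightarrow> f t = g s)"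

lemma orth_sym: "orth f g \<Longrightarrow> orth g f"
  unfolding orth_def by metis

lemma orthD: "orth f g \<Longrightarrow> f s = g t \<Longrightarrow> f t = g s"
  unfolding orth_def by blast

lemma orth_id_iff: "orth id h \<longleftrightarrow> (\<forall>s. h (h s) = s)"
  unfolding orth_def by auto

lemma orth_comp_iff: "inj k \<Longrightarrow> orth (k \<circ> f) (k \<circ> g) \<longleftrightarrow> orth f g"
  unfolding orth_def by (simp add: inj_eq)

text \<open>The second claim of the theorem localized at a single circle, so that it can be
  propagated from circle to circle.\<close>

definition orth_common_le1 :: "'a set \<Rightarrow> ('a \<Rightarrow> 'a) set \<Rightarrow> ('a \<Rightarrow> 'a) \<Rightarrow> bool" where
  "orth_common_le1 X F f \<longleftrightarrow>
    (\<forall>g\<in>F. orth f g \<longrightarrow> f \<noteq> g \<longrightarrow> (\<forall>u\<in>X. \<forall>v\<in>X. f u = g u \<longrightarrow> f v = g v \<longrightarrow> u = v))"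

text \<open>\<open>ex_map\<close> and \<open>map_unique\<close> are H4 in coordinates,
  \<open>orthI\<close> is the symmetry axiom, and \<open>three\<close> comes from H5.\<close>

locale symmetric_permutations =
  fixes X :: "'a set" and F :: "('a \<Rightarrow> 'a) set"
  assumes permutes: "f \<in> F \<Longrightarrow> f permutes X"
    and ex_map: "\<lbrakk>x \<in> X; y \<in> X; z \<in> X; x \<noteq> y; y \<noteq> z; z \<noteq> x;
      x' \<in> X; y' \<in> X; z' \<in> X; x' \<noteq> y'; y' \<noteq> z'; z' \<noteq> x'\<rbrakk>
      \<Longrightarrow> \<exists>f\<in>F. f x = x' \<and> f y = y' \<and> f z = z'"
    and map_unique: "\<lbrakk>f \<in> F; g \<in> F; x \<in> X; y \<in> X; z \<in> X; x \<noteq> y; y \<noteq> z; z \<noteq> x;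
      f x = g x; f y = g y; f z = g z\<rbrakk> \<Longrightarrow> f = g"
    and orthI: "\<lbrakk>f \<in> F; g \<in> F; u \<in> X; v \<in> X; u \<noteq> v; f u = g v; f v = g u\<rbrakk> \<Longrightarrow> orth f g"
    and three: "\<exists>x\<in>X. \<exists>y\<in>X. \<exists>z\<in>X. x \<noteq> y \<and> y \<noteq> z \<and> z \<noteq> x"
begin

lemma bij: "f \<in> F \<Longrightarrow> bij f"
  using permutes permutes_bij by blast

lemma inj_iff [simp]: "f \<in> F \<Longrightarrow> f x = f y \<longleftrightarrow> x = y"
  using bij[of f] by (simp add: bij_def inj_eq)

lemma in_iff [simp]: "f \<in> F \<Longrightarrow> f x \<in> X \<longleftrightarrow> x \<in> X"
  using permutes[of f] by (simp add: permutes_in_image)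

lemma ex_preimage: "f \<in> F \<Longrightarrow> \<exists>x. f x = y"
  using bij[of f] by (metis bij_pointE)

lemma third: assumes "u \<in> X" "v \<in> X" shows "\<exists>w\<in>X. w \<noteq> u \<and> w \<noteq> v"
  using three by metis

lemma ex_moved: assumes "f \<in> F" "g \<in> F" "f \<noteq> g" shows "\<exists>x\<in>X. f x \<noteq> g x"
  using three map_unique[OF assms(1,2)] assms(3) by metis

end

section \<open>Base change: making a chosen permutation the identity\<close>

locale symmetric_permutations_id = symmetric_permutations +
  assumes id_in: "id \<in> F"

text \<open>Left multiplication by \<open>inv k\<close> cancels in \<open>inv f \<circ> g\<close>,
  so it preserves orthogonality while sending \<open>k\<close> to the identity. Questions about two
  permutations thus reduce to the identity and one other.\<close>

lemma (in symmetric_permutations) base_change: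
  assumes k: "k \<in> F"
  shows "symmetric_permutations_id X ((\<circ>) (inv k) ` F)"
proof
  have surj: "k (inv k y) = y" for y
    using bij[OF k] by (simp add: bij_def surj_f_inv_f)
  have inj: "inv k y = inv k z \<longleftrightarrow> y = z" for y z
    using surj by metis
  have kX: "inv k permutes X" using permutes[OF k] by (rule permutes_inv)
  have ik: "inj (inv k)" by (simp add: inj inj_def)
  show "f permutes X" if "f \<in> (\<circ>) (inv k) ` F" for f
    using that permutes permutes_compose[OF _ kX] by auto
  show "id \<in> (\<circ>) (inv k) ` F"
    using k bij[OF k] by (auto simp: image_iff bij_def intro!: bexI[of _ k])
  show "f = g" if fg: "f \<in> (\<circ>) (inv k) ` F" "g \<in> (\<circ>) (inv k) ` F"
    "x \<in> X" "y \<in> X" "z \<in> X" "x \<noteq> y" "y \<noteq> z" "z \<noteq> x" "f x = g x" "f y = g y" "f z = g z"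
    for f g x y z
  proof -
    obtain f' g' where "f' \<in> F" "g' \<in> F" "f = inv k \<circ> f'" "g = inv k \<circ> g'" using fg by auto
    moreover have "f' = g'"
      using calculation fg map_unique[of f' g' x y z] by (simp add: inj)
    ultimately show ?thesis by simp
  qed
  show "orth f g" if "f \<in> (\<circ>) (inv k) ` F" "g \<in> (\<circ>) (inv k) ` F"
    "u \<in> X" "v \<in> X" "u \<noteq> v" "f u = g v" "f v = g u" for f g u v
    using that orthI[of _ _ u v] by (auto simp: inj orth_comp_iff[OF ik])
next
  have inv: "inv k (k y) = y" for y
    using bij[OF k] by (simp add: bij_def)
  fix x y z x' y' z'
  assume "x \<in> X" "y \<in> X" "z \<in> X" "x \<noteq> y" "y \<noteq> z" "z \<noteq> x"
      "x' \<in> X" "y' \<in> X" "z' \<in> X" "x' \<noteq> y'" "y' \<noteq> z'" "z' \<noteq> x'"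
  then obtain f where "f \<in> F" "f x = k x'" "f y = k y'" "f z = k z'"
    using ex_map[of x y z "k x'" "k y'" "k z'"] k by auto
  then show "\<exists>f\<in>(\<circ>) (inv k) ` F. f x = x' \<and> f y = y' \<and> f z = z'"
    by (intro bexI[of _ "inv k \<circ> f"]) (simp_all add: inv)
qed (rule three)

lemma (in symmetric_permutations) orth_common_le1_base_change:
  assumes k: "k \<in> F" and f: "f \<in> F"
  shows "orth_common_le1 X ((\<circ>) (inv k) ` F) (inv k \<circ> f) \<longleftrightarrow> orth_common_le1 X F f"
proof -
  have ik: "inj (inv k)" using bij[OF k] bij_imp_bij_inv bij_def by blast
  have "inv k \<circ> f = inv k \<circ> g \<longleftrightarrow> f = g" for g
    by (simp add: fun_eq_iff inj_eq[OF ik])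
  then show ?thesis
    unfolding orth_common_le1_def by (simp add: orth_comp_iff[OF ik] inj_eq[OF ik])
qed

section \<open>Closure under inverses\<close>

context symmetric_permutations_id
begin

lemma involution_if_swap:
  assumes "h \<in> F" "u \<in> X" "u \<noteq> v" "h u = v" "h v = u"
  shows "h (h s) = s"
  using orthI[OF id_in, of h u v] assms in_iff[of h u] by (auto simp: orth_id_iff)

text \<open>Exchanging \<open>u\<close> and \<open>v\<close> already forces an involution, hence the
  value at \<open>w'\<close>. Taking \<open>w' = w\<close> prescribes a fixed point.\<close>

lemma ex_swap:
  assumes "u \<in> X" "v \<in> X" "u \<noteq> v" "w \<in> X" "w \<noteq> u" "w \<noteq> v" "w' \<in> X" "w' \<noteq> u" "w' \<noteq> v"
  obtains h where "h \<in> F" "\<And>s. h (h s) = s" "h u = v" "h v = u" "h w = w'" "h w' = w"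
  using ex_map[of u v w v u w'] involution_if_swap assms by metis

text \<open>The candidate is the element \<open>l\<close> of \<open>F\<close> that undoes
  \<open>g\<close> at three successive images of a moved point; comparing it with the candidates
  \<open>l'\<close> through other moved points shows that it undoes \<open>g\<close>
  everywhere.\<close>

lemma inverse_in:
  assumes g: "g \<in> F"
  shows "inv g \<in> F"
proof (cases "\<exists>x\<in>X. g x \<noteq> x \<and> g (g x) = x")
  case True
  then have "g (g s) = s" for s using involution_if_swap[OF g] by metis
  then have "inv g = g" by (intro inv_equality) auto
  with g show ?thesis by simp
next
  case False
  then have no2: "g (g x) \<noteq> x" if "x \<in> X" "g x \<noteq> x" for x using that by blast
  show ?thesis
  proof (cases "g = id")
    case False
    then obtain x where x: "x \<in> X" "g x \<noteq> x" using ex_moved[OF g id_in] by auto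
    define x1 x2 x3 where xi: "x1 = g x" "x2 = g x1" "x3 = g x2"
    have xX: "x1 \<in> X" "x2 \<in> X" "x3 \<in> X" using xi x g by auto
    \<comment> \<open>Excluding 2-cycles makes \<open>x\<close>, \<open>x1\<close>,
      \<open>x2\<close> distinct, and likewise \<open>x1\<close>, \<open>x2\<close>,
      \<open>x3\<close>; \<open>x3 = x\<close> remains possible.\<close>
    have d: "x1 \<noteq> x" "x2 \<noteq> x1" "x2 \<noteq> x" "x3 \<noteq> x2" "x3 \<noteq> x1"
      using xi x g no2[of x] no2[of x1] by auto
    obtain l where l: "l \<in> F" "l x1 = x" "l x2 = x1" "l x3 = x2"
      using ex_map[of x1 x2 x3 x x1 x2] x xX d by metis
    have moved: "l (g w) = w" if w: "w \<in> X" "g w \<noteq> w" for w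
    proof (cases "w \<in> {x, x1, x2}")
      case True then show ?thesis using l xi by auto
    next
      case False
      then have dw: "w \<noteq> x" "w \<noteq> x1" "w \<noteq> x2" by auto
      define w1 where "w1 = g w"
      have w1: "w1 \<in> X" "w1 \<noteq> w" "w1 \<noteq> x1" "w1 \<noteq> x2" using w dw w1_def xi g by auto
      obtain l' where l': "l' \<in> F" "l' x1 = x" "l' x2 = x1" "l' w1 = w"
        using ex_map[of x1 x2 w1 x x1 w] x xX d w w1 dw by metis
      obtain v where v: "g v = w" using ex_preimage[OF g] by blast
      txt \<open>With $x_i = g^i x$ and $w_i = g^i w$, the maps $m$ and $n$ are orthogonal to the identity,
        to $g$ and to $l'$, and swap $x_i$ with $w_{1-i}$ and $w_{2-i}$ respectively.\<close>
      obtain m where m: "m \<in> F" "\<And>s. m (m s) = s" "m x1 = w" "m x = w1"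
        using ex_swap[of x1 w x w1] x xX d w w1 dw by metis
      obtain n where n: "n \<in> F" "\<And>s. n (n s) = s" "n x1 = w1" "n x2 = w"
        using ex_swap[of x1 w1 x2 w] x xX d w w1 dw by metis
      have sw: "m w = x1" "m w1 = x" "n w1 = x1" "n w = x2" using m n by metis+
      have "orth g m" using orthI[OF g m(1), of x w] x w dw m sw xi w1_def by simp
      have "orth g n" using orthI[OF g n(1), of x1 w] xX w dw n sw xi w1_def by simp
      have "orth l' m" using orthI[OF l'(1) m(1), of x1 w1] xX w1 m sw l' by simp
      have "orth l' n" using orthI[OF l'(1) n(1), of x2 w1] xX w1 n sw l' by simp
      \<comment> \<open>Orthogonality to \<open>g\<close> pushes the swap of \<open>x1\<close> and
        \<open>w\<close> one step along both orbits, to \<open>x2\<close> and \<open>v\<close>;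
        orthogonality to \<open>l'\<close> then gives \<open>l' w\<close>. In the same way
        \<open>n\<close> gives \<open>l' x3\<close>.\<close>
      have "g (m x2) = g v" using orthD[OF \<open>orth g m\<close>, of x1 "m x2"] xi m v by simp
      then have "m x2 = v" using g by simp
      then have "l' w = v" using orthD[OF \<open>orth l' m\<close>, of x2 w] l' sw by simp
      have "n v = x3" using orthD[OF \<open>orth g n\<close>, of v x2] v n xi by simp
      then have "l' x3 = x2" using orthD[OF \<open>orth l' n\<close>, of w x3] \<open>l' w = v\<close> n(2)[of v] sw by simp
      then have "l = l'" using map_unique[OF l(1) l'(1), of x1 x2 x3] l l' d xX by simp
      then show ?thesis using l' w1_def by simp
    qed
    have fixed: "l w = w" if w: "w \<in> X" "g w = w" for w
    proof (rule ccontr)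
      \<comment> \<open>By \<open>moved\<close>, \<open>l\<close> preserves the fixed points of
        \<open>g\<close>. As \<open>g \<noteq> id\<close> has at most two of them, \<open>l\<close>
        would swap \<open>w\<close> and \<open>l w\<close> and be an involution, against
        \<open>l x2 = x1\<close> and \<open>l x1 = x\<close>.\<close>
      have stays: "g (l s) = l s" if s: "s \<in> X" "g s = s" for s
        using moved[of "l s"] s l(1) g by (metis in_iff inj_iff)
      assume ne: "l w \<noteq> w"
      have "l (l w) = w"
        using map_unique[OF g id_in, of w "l w" "l (l w)"] stays w ne \<open>g \<noteq> id\<close> l(1) by auto
      then have "l (l s) = s" for s using involution_if_swap[OF l(1), of w "l w"] w ne by simp
      then show False using l d by metis
    qed
    have "l (g w) = w" for w
      using moved fixed permutes_not_in[OF permutes[OF g]] permutes_not_in[OF permutes[OF l(1)]]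
      by metis
    then have "inv g = l" using ex_preimage[OF g] by (intro inv_equality) (auto, metis)
    with l show ?thesis by simp
  qed (use id_in in simp)
qed

end

text \<open>After base change at \<open>f\<close> this is closure under inverses. Geometrically, the
  result is the mirror image of the circle of \<open>g\<close> in the circle of
  \<open>f\<close>.\<close>

lemma (in symmetric_permutations) sandwich_in:
  assumes f: "f \<in> F" and g: "g \<in> F"
  shows "f \<circ> inv g \<circ> f \<in> F"
proof -
  interpret B: symmetric_permutations_id X "(\<circ>) (inv f) ` F" by (rule base_change[OF f])
  have "inv (inv f \<circ> g) \<in> (\<circ>) (inv f) ` F" using g by (intro B.inverse_in) simp
  then obtain h where h: "h \<in> F" "inv (inv f \<circ> g) = inv f \<circ> h" by auto
  have "inv (inv f \<circ> g) = inv g \<circ> f"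
    using bij[OF f] bij[OF g] by (simp add: o_inv_distrib bij_imp_bij_inv inv_inv_eq)
  then have "f \<circ> (inv g \<circ> f) = f \<circ> inv f \<circ> h" using h by (simp add: comp_assoc)
  then have "h = f \<circ> inv g \<circ> f" using bij[OF f] by (simp add: bij_def surj_iff fun_eq_iff)
  with h show ?thesis by simp
qed

section \<open>Conjugation of involutions and their fixed points\<close>

context symmetric_permutations_id
begin

lemma conjugate_in:
  assumes "a \<in> F" "\<And>s. a (a s) = s" "r \<in> F" "\<And>s. r (r s) = s"
  shows "a \<circ> r \<circ> a \<in> F"
proof -
  have "inv r = r" using assms(4) by (intro inv_equality) auto
  then show ?thesis using sandwich_in[OF assms(1,3)] by simp
qed

text \<open>If \<open>p\<close> were the only fixed point of \<open>g\<close>, each point moved by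
  \<open>f\<close> would be moved by \<open>g\<close> too, which allows conjugating \<open>f\<close>
  into \<open>g\<close> by a map fixing \<open>p\<close>.\<close>

lemma fixed_point_transfer:
  assumes f: "f \<in> F" "\<And>s. f (f s) = s" "f \<noteq> id" and g: "g \<in> F" "\<And>s. g (g s) = s"
    and p: "p \<in> X" "f p = p" "g p = p" and c: "c \<in> X" "c \<noteq> p" "f c = c"
  shows "\<exists>d\<in>X. d \<noteq> p \<and> g d = d"
proof (rule ccontr)
  assume none: "\<not> ?thesis"
  txt \<open>The product $b a$ below fixes $p$ and $x$ and sends $f x$ to $g x$, so it conjugates $f$ into
    $g$ by sharp 3-transitivity.\<close>
  obtain x where x: "x \<in> X" "f x \<noteq> x" using ex_moved[OF f(1) id_in f(3)] by auto
  then have "x \<noteq> p" "g x \<noteq> x" using p none by auto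
  then have d: "f x \<noteq> p" "g x \<noteq> p" using p f(1) g(1) by (metis inj_iff)+
  obtain a where a: "a \<in> F" "\<And>s. a (a s) = s" "a p = x" "a x = p" "a (f x) = g x" "a (g x) = f x"
    using ex_swap[of p x "f x" "g x"] p x f(1) g(1) d \<open>x \<noteq> p\<close> \<open>g x \<noteq> x\<close> by (metis in_iff)
  obtain b where b: "b \<in> F" "\<And>s. b (b s) = s" "b p = x" "b x = p" "b (g x) = g x"
    using ex_swap[of p x "g x" "g x"] p x g(1) d \<open>x \<noteq> p\<close> \<open>g x \<noteq> x\<close> by (metis in_iff)
  have afa: "a \<circ> f \<circ> a \<in> F" using conjugate_in a f by blast
  have bafab: "b \<circ> (a \<circ> f \<circ> a) \<circ> b \<in> F" using conjugate_in[OF b(1,2) afa] a f by simp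
  have "b \<circ> (a \<circ> f \<circ> a) \<circ> b = g"
    using map_unique[OF bafab g(1), of p x "g x"] p x g f a b d \<open>x \<noteq> p\<close> \<open>g x \<noteq> x\<close> by simp
  \<comment> \<open>The conjugation carries the fixed point \<open>c\<close> of \<open>f\<close> to
    the fixed point \<open>b (a c)\<close> of \<open>g\<close>; since \<open>b (a p) = p\<close>, it
    differs from \<open>p\<close>.\<close>
  then have "g (b (a c)) = b (a (f (a (b (b (a c))))))" by (metis comp_apply)
  then have "g (b (a c)) = b (a c)" using a(2) b(2) c by simp
  moreover have "b (a c) \<noteq> p" using a b c by metis
  moreover have "b (a c) \<in> X" using a b c by simp
  ultimately show False using none by blast
qed

text \<open>Two conjugations move the fixed points of \<open>r\<close>: \<open>a\<close> takes
  \<open>x\<close> to \<open>u\<close>, then \<open>b\<close> keeps \<open>u\<close> and takes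
  \<open>a y\<close> to \<open>v\<close>.\<close>

lemma ex_involution_fixing:
  assumes r: "r \<in> F" "\<And>s. r (r s) = s" "r \<noteq> id" and xy: "x \<in> X" "y \<in> X" "x \<noteq> y" "r x = x" "r y = y"
    and uv: "u \<in> X" "v \<in> X" "u \<noteq> v"
  shows "\<exists>r'\<in>F. (\<forall>s. r' (r' s) = s) \<and> r' \<noteq> id \<and> r' u = u \<and> r' v = v"
proof -
  have conj: "a \<circ> r \<circ> a \<in> F \<and> (\<forall>s. (a \<circ> r \<circ> a) ((a \<circ> r \<circ> a) s) = s) \<and> a \<circ> r \<circ> a \<noteq> id
      \<and> (a \<circ> r \<circ> a) (a x) = a x \<and> (a \<circ> r \<circ> a) (a y) = a y"
    if a: "a \<in> F" "\<And>s. a (a s) = s" and r: "r \<in> F" "\<And>s. r (r s) = s" "r \<noteq> id" "r x = x" "r y = y"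
    for a r x y
  proof -
    obtain s where "r s \<noteq> s" using r by (auto simp: fun_eq_iff)
    then have "(a \<circ> r \<circ> a) (a s) \<noteq> a s" using a by (metis comp_apply)
    then have "a \<circ> r \<circ> a \<noteq> id" by (metis id_apply)
    then show ?thesis using conjugate_in[OF a r(1,2)] a r by simp
  qed
  have "\<exists>a\<in>F. (\<forall>s. a (a s) = s) \<and> a x = u"
  proof (cases "x = u")
    case False
    obtain w where "w \<in> X" "w \<noteq> x" "w \<noteq> u" using third xy uv by blast
    then show ?thesis using ex_swap[of x u w w] xy uv False by metis
  qed (use id_in in \<open>auto intro: bexI[of _ id]\<close>)
  then obtain a where a: "a \<in> F" "\<And>s. a (a s) = s" "a x = u" by blast
  have y': "a y \<in> X" "a y \<noteq> u" using a xy by (simp, metis inj_iff)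
  have "\<exists>b\<in>F. (\<forall>s. b (b s) = s) \<and> b u = u \<and> b (a y) = v"
  proof (cases "a y = v")
    case False
    then show ?thesis using ex_swap[of "a y" v u u] y' uv by metis
  qed (use id_in in \<open>auto intro: bexI[of _ id]\<close>)
  then obtain b where b: "b \<in> F" "\<And>s. b (b s) = s" "b u = u" "b (a y) = v" by blast
  note c = conj[OF a(1,2) r xy(4,5)]
  show ?thesis
    using conj[OF b(1,2), of "a \<circ> r \<circ> a" "a x" "a y"] c a(3) b(3,4)
    by (intro bexI[of _ "b \<circ> (a \<circ> r \<circ> a) \<circ> b"]) simp_all
qed

section \<open>Absence of orthogonal secants and its propagation\<close>

text \<open>An orthogonal secant could be conjugated to one through the touching point of
  \<open>t\<close>, and \<open>fixed_point_transfer\<close> would give \<open>t\<close> a second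
  fixed point.\<close>

lemma orth_common_le1_id:
  assumes t: "t \<in> F" "orth id t" and p: "\<exists>!p. p \<in> X \<and> t p = p"
  shows "orth_common_le1 X F id"
  unfolding orth_common_le1_def
proof (intro ballI impI, rule ccontr)
  fix g u v
  assume g: "g \<in> F" "orth id g" "id \<noteq> g" and uv: "u \<in> X" "v \<in> X" "id u = g u" "id v = g v" "u \<noteq> v"
  obtain p where p': "p \<in> X" "t p = p" using p by blast
  obtain q where q: "q \<in> X" "q \<noteq> p" using third p' by blast
  obtain r where r: "r \<in> F" "\<And>s. r (r s) = s" "r \<noteq> id" "r p = p" "r q = q"
    using ex_involution_fixing[of g u v p q] g uv p' q by (auto simp: orth_id_iff)
  then show False using fixed_point_transfer[of r t p q] t p p' q by (auto simp: orth_id_iff)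
qed

text \<open>One step of the propagation: a secant \<open>m\<close> orthogonal to \<open>n\<close> is
  turned into a nonidentity involution of \<open>F\<close> with two fixed points.\<close>

lemma orth_common_le1_orth_id:
  assumes id1: "orth_common_le1 X F id" and n: "n \<in> F" "orth id n" "n \<noteq> id"
  shows "orth_common_le1 X F n"
  unfolding orth_common_le1_def
proof (intro ballI impI, rule ccontr)
  fix m u v
  assume m: "m \<in> F" "orth n m" "n \<noteq> m" and uv: "u \<in> X" "v \<in> X" "n u = m u" "n v = m v" "u \<noteq> v"
  interpret B: symmetric_permutations_id X "(\<circ>) (inv n) ` F" by (rule base_change[OF n(1)])
  have nn: "n (n s) = s" for s using n by (simp add: orth_id_iff)
  then have inv: "inv n = n" by (intro inv_equality) auto
  obtain x where x: "x \<in> X" "n x \<noteq> x" using ex_moved[OF n(1) id_in n(3)] by auto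
  have nm: "(n \<circ> m) ((n \<circ> m) s) = s" for s
    using orthD[OF m(2), of "n (m s)" s] nn by (metis comp_apply)
  have "n \<circ> m \<noteq> id" using m(3) nn by (metis comp_apply ext id_apply)
  txt \<open>Moving the two common points to $x$ and $n x$ makes the second circle orthogonal to the
    identity as well; then $F$ contains an involution fixing both $x$ and $n x$.\<close>
  then obtain r where r: "r \<in> (\<circ>) (inv n) ` F" "\<And>s. r (r s) = s" "r \<noteq> id" "r x = x" "r (n x) = n x"
    using B.ex_involution_fixing[of "n \<circ> m" u v x "n x", OF _ nm] m(1) uv x n(1) inv nn
    by (metis comp_apply image_eqI in_iff)
  obtain l where l: "l \<in> F" "r = n \<circ> l" using r inv by auto
  have lx: "l x = n x" "l (n x) = x" using r l nn by (metis comp_apply)+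
  have ll: "l (l s) = s" for s using involution_if_swap[OF l(1), of x "n x"] x lx by auto
  have comm: "n (l s) = l (n s)" for s using r(2)[of "l (n s)"] l ll nn by (metis comp_apply)
  have "l \<noteq> n" using r(3) l(2) nn by (auto simp: comp_def id_def)
  then obtain z where z: "z \<in> X" "l z \<noteq> n z" using ex_moved[OF l(1) n(1)] by blast
  have zx: "z \<noteq> x" "z \<noteq> n x" using z lx nn by auto
  have "r z \<noteq> z" using z l nn by (metis comp_apply)
  moreover have "r z \<noteq> x" "r z \<noteq> n x" using r zx by metis+
  moreover have "r z \<in> X" using z l n by simp
  ultimately have rz: "r z \<in> X" "r z \<noteq> x" "r z \<noteq> n x" "r z \<noteq> z" by auto
  \<comment> \<open>\<open>h\<close> fixes \<open>x\<close> and \<open>n x\<close> while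
    \<open>l\<close> and \<open>n\<close> swap them, so \<open>h\<close> is orthogonal to both. The
    two relations together give \<open>h (r z) = z\<close>, which makes \<open>h\<close> an
    involution.\<close>
  obtain h where h: "h \<in> F" "h x = x" "h (n x) = n x" "h z = r z"
    using ex_map[of x "n x" z x "n x" "r z"] x zx rz z n by (metis in_iff)
  have "orth h l" using orthI[OF h(1) l(1), of x "n x"] x n h lx by simp
  then have "h (n z) = l z" using orthD[of h l z "n z"] h l comm by simp
  have "orth h n" using orthI[OF h(1) n(1), of x "n x"] x n h nn by simp
  then have "h (r z) = z" using orthD[of h n "n z" "r z"] \<open>h (n z) = l z\<close> l nn by simp
  then have "h (h s) = s" for s using involution_if_swap[OF h(1) z(1)] rz h by metis
  then have "orth id h" by (simp add: orth_id_iff)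
  moreover have "id \<noteq> h" using h rz by auto
  moreover have "n x \<in> X" using n x by simp
  ultimately show False using id1 h x unfolding orth_common_le1_def by (metis id_apply)
qed

text \<open>The witness fixes \<open>x\<close> and swaps \<open>g x\<close> with the preimage of
  \<open>x\<close>. It is a common orthogonal circle of \<open>id\<close> and \<open>g\<close>,
  distinct from both, and conjugates \<open>g\<close> into its inverse.\<close>

lemma ex_orth_fixing:
  assumes g: "g \<in> F" and x: "x \<in> X" "g (g x) \<noteq> x"
  obtains n where "n \<in> F" "orth id n" "orth g n" "n x = x" "n (g x) \<noteq> g x"
proof -
  obtain y where y: "g y = x" using ex_preimage[OF g] by blast
  then have yX: "y \<in> X" using in_iff[OF g, of y] x by simp
  have d: "x \<noteq> g x" "x \<noteq> y" "y \<noteq> g x" using x y by auto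
  obtain n where n: "n \<in> F" "\<And>s. n (n s) = s" "n (g x) = y" "n y = g x" "n x = x"
    using ex_swap[of "g x" y x x] g x yX d by (metis in_iff)
  then have "orth g n" using orthI[OF g n(1), of x y] x yX y d by simp
  then show ?thesis using that n d by (auto simp: orth_id_iff)
qed

text \<open>Unless \<open>g\<close> is equal or orthogonal to the identity, a common orthogonal
  \<open>n\<close> links the two and the propagation step applies twice, the second time based at
  \<open>n\<close>.\<close>

lemma orth_common_le1_from_id:
  assumes id1: "orth_common_le1 X F id" and g: "g \<in> F"
  shows "orth_common_le1 X F g"
proof (cases "\<forall>x\<in>X. g (g x) = x")
  case True
  then have "orth id g"
    using permutes_not_in[OF permutes[OF g]] by (metis orth_id_iff)
  then show ?thesis using orth_common_le1_orth_id[OF id1 g] id1 by (cases "g = id") auto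
next
  case False
  then obtain x where x: "x \<in> X" "g (g x) \<noteq> x" by blast
  obtain n where n: "n \<in> F" "orth id n" "orth g n" "n x = x" "n (g x) \<noteq> g x"
    using ex_orth_fixing[OF g x] .
  have n1: "orth_common_le1 X F n" using orth_common_le1_orth_id[OF id1 n(1,2)] n(5) by (metis id_apply)
  interpret B: symmetric_permutations_id X "(\<circ>) (inv n) ` F" by (rule base_change[OF n(1)])
  have inj: "inj (inv n)" using bij[OF n(1)] bij_imp_bij_inv bij_def by blast
  have inv: "inv n \<circ> n = id" using bij[OF n(1)] by (simp add: bij_def)
  have "orth_common_le1 X ((\<circ>) (inv n) ` F) id"
    using orth_common_le1_base_change[OF n(1) n(1)] n1 inv by simp
  moreover have "orth id (inv n \<circ> g)"
    using orth_comp_iff[OF inj, of n g] orth_sym[OF n(3)] inv by simp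
  moreover have "inv n \<circ> g \<noteq> id"
  proof
    assume "inv n \<circ> g = id"
    then have "n = n \<circ> inv n \<circ> g" by (simp add: comp_assoc)
    then have "n = g" using bij[OF n(1)] by (simp add: bij_def surj_iff)
    then show False using n x by auto
  qed
  ultimately have "orth_common_le1 X ((\<circ>) (inv n) ` F) (inv n \<circ> g)"
    using B.orth_common_le1_orth_id g by blast
  then show ?thesis using orth_common_le1_base_change[OF n(1) g] by simp
qed

lemma orth_id_if_common_unique:
  assumes id1: "orth_common_le1 X F id" and g: "g \<in> F" and p: "p \<in> X" "g p = p"
    and unique: "\<And>q. q \<in> X \<Longrightarrow> g q = q \<Longrightarrow> q = p"
  shows "orth id g"
proof (rule ccontr)
  assume "\<not> orth id g"
  then obtain x where x: "x \<in> X" "g (g x) \<noteq> x"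
    using permutes_not_in[OF permutes[OF g]] by (metis orth_id_iff)
  obtain n where n: "n \<in> F" "orth id n" "orth g n" "n x = x" "n (g x) \<noteq> g x"
    using ex_orth_fixing[OF g x] .
  \<comment> \<open>Inverting \<open>g\<close> under conjugation, \<open>n\<close> preserves the
    fixed points of \<open>g\<close>, of which \<open>p\<close> is the only one.\<close>
  have "g (n p) = n p" using orthD[OF n(3), of p "n p"] n(2) p by (simp add: orth_id_iff)
  then have "n p = p" using unique[of "n p"] p n(1) by simp
  moreover have "x \<noteq> p" using x p by auto
  moreover have "id \<noteq> n" using n by auto
  ultimately show False using id1 n x p unfolding orth_common_le1_def by (metis id_apply)
qed

end

section \<open>Transfer to an arbitrary base permutation\<close>

context symmetric_permutations
begin

lemma base_change_facts:
  assumes k: "k \<in> F"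
  shows "orth id (inv k \<circ> f) \<longleftrightarrow> orth k f" and "inv k (f x) = x \<longleftrightarrow> f x = k x" and "inv k \<circ> k = id"
proof -
  have inj: "inj (inv k)" using bij[OF k] bij_imp_bij_inv bij_def by blast
  show inv: "inv k \<circ> k = id" using bij[OF k] by (simp add: bij_def)
  then show "orth id (inv k \<circ> f) \<longleftrightarrow> orth k f" using orth_comp_iff[OF inj, of k f] by simp
  show "inv k (f x) = x \<longleftrightarrow> f x = k x" using inj inv by (metis comp_apply id_apply inj_eq)
qed

text \<open>Seen from \<open>k\<close>, the given pair is the identity and an involution with a
  single fixed point, as \<open>orth_common_le1_id\<close> requires; propagation then reaches every
  \<open>f\<close>.\<close>

lemma orth_common_le1_all:
  assumes k: "k \<in> F" and l: "l \<in> F" "orth k l" "\<exists>!p. p \<in> X \<and> l p = k p" and f: "f \<in> F"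
  shows "orth_common_le1 X F f"
proof -
  interpret B: symmetric_permutations_id X "(\<circ>) (inv k) ` F" by (rule base_change[OF k])
  have "orth_common_le1 X ((\<circ>) (inv k) ` F) id"
    using B.orth_common_le1_id[of "inv k \<circ> l"] l base_change_facts[OF k] by simp
  then show ?thesis
    using B.orth_common_le1_from_id[of "inv k \<circ> f"] f orth_common_le1_base_change[OF k f] by simp
qed

lemma orth_if_common_unique:
  assumes f: "f \<in> F" "orth_common_le1 X F f" and g: "g \<in> F" "\<exists>!p. p \<in> X \<and> g p = f p"
  shows "orth f g"
proof -
  interpret B: symmetric_permutations_id X "(\<circ>) (inv f) ` F" by (rule base_change[OF f(1)])
  note bc = base_change_facts[OF f(1)]
  obtain p where p: "p \<in> X" "g p = f p" and u: "\<And>q. q \<in> X \<Longrightarrow> g q = f q \<Longrightarrow> q = p" using g by blast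
  have "orth_common_le1 X ((\<circ>) (inv f) ` F) id"
    using orth_common_le1_base_change[OF f(1) f(1)] f(2) bc by simp
  then have "orth id (inv f \<circ> g)"
  proof (rule B.orth_id_if_common_unique[where p = p])
    show "q = p" if "q \<in> X" "(inv f \<circ> g) q = q" for q
      using that by (intro u) (simp_all add: bc)
  qed (use g(1) p bc in auto)
  then show ?thesis using bc by simp
qed

end

section \<open>Coordinates on a circle \<open>E\<close>, and circles as permutations of
  \<open>E\<close>\<close>

context hyperbola_structure
begin

lemma gen_in_P: "p \<in> P \<Longrightarrow> q \<in> gen1 p \<or> q \<in> gen2 p \<Longrightarrow> q \<in> P"
  using gen1 gen2 gens1_subset gens2_subset by blast

lemma gen1_cong: "p \<in> P \<Longrightarrow> q \<in> gen1 p \<Longrightarrow> gen1 q = gen1 p"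
  using gen1 gen1_eqI by blast

lemma gen2_cong: "p \<in> P \<Longrightarrow> q \<in> gen2 p \<Longrightarrow> gen2 q = gen2 p"
  using gen2 gen2_eqI by blast

lemma meet_in_P: "p \<in> P \<Longrightarrow> q \<in> P \<Longrightarrow> meet p q \<in> P"
  using meet_in(1) gen_in_P by blast

lemma meet_meet:
  assumes "x \<in> P" "y \<in> P" "u \<in> P" "v \<in> P"
  shows "meet (meet x y) (meet u v) = meet x v"
  unfolding meet_def[of "meet x y"] meet_def[of x v]
  using assms by (simp add: gen1_cong[OF _ meet_in(1)] gen2_cong[OF _ meet_in(2)])

lemma circle_in_P: "K \<in> \<Lambda> \<Longrightarrow> p \<in> K \<Longrightarrow> p \<in> P"
  using circles_subset by blast

lemma circle_gen1_ex1: "K \<in> \<Lambda> \<Longrightarrow> p \<in> P \<Longrightarrow> \<exists>!q. q \<in> gen1 p \<and> q \<in> K"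
  using H3[of "gen1 p" K] gen1 by auto

lemma circle_gen2_ex1: "K \<in> \<Lambda> \<Longrightarrow> p \<in> P \<Longrightarrow> \<exists>!q. q \<in> gen2 p \<and> q \<in> K"
  using H3[of "gen2 p" K] gen2 by auto

lemma gen1_eq_iff: "K \<in> \<Lambda> \<Longrightarrow> p \<in> K \<Longrightarrow> q \<in> K \<Longrightarrow> gen1 p = gen1 q \<longleftrightarrow> p = q"
  using circle_gen1_ex1[of K p] circle_in_P gen1(2) by metis

lemma gen2_eq_iff: "K \<in> \<Lambda> \<Longrightarrow> p \<in> K \<Longrightarrow> q \<in> K \<Longrightarrow> gen2 p = gen2 q \<longleftrightarrow> p = q"
  using circle_gen2_ex1[of K p] circle_in_P gen2(2) by metis

lemma meet_eq_iff:
  assumes "E \<in> \<Lambda>" "x \<in> E" "y \<in> E" "u \<in> E" "v \<in> E"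
  shows "meet x y = meet u v \<longleftrightarrow> x = u \<and> y = v"
  using assms by (metis circle_in_P gen1_cong gen2_cong gen1_eq_iff gen2_eq_iff meet_in)

lemma ex_coordinates:
  assumes E: "E \<in> \<Lambda>" and p: "p \<in> P"
  obtains x y where "x \<in> E" "y \<in> E" "p = meet x y"
proof -
  obtain x where x: "x \<in> gen1 p" "x \<in> E" using circle_gen1_ex1[OF assms] by blast
  obtain y where y: "y \<in> gen2 p" "y \<in> E" using circle_gen2_ex1[OF assms] by blast
  have "gen1 x = gen1 p" "gen2 y = gen2 p" using x y gen1_cong gen2_cong p by auto
  then have "meet x y = p" using meet_eqI circle_in_P[OF E] x y gen1(2) gen2(2) p by simp
  then show ?thesis using that x y by blast
qed

text \<open>This is H3 for the generator of \<open>\<Sigma>1\<close> through \<open>x\<close>; the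
  column version is H3 for \<open>\<Sigma>2\<close>. Together they make a circle the graph of a
  permutation.\<close>

lemma circle_row_ex1:
  assumes E: "E \<in> \<Lambda>" and L: "L \<in> \<Lambda>" and x: "x \<in> E"
  shows "\<exists>!y. y \<in> E \<and> meet x y \<in> L"
proof -
  have xP: "x \<in> P" using E x by (rule circle_in_P)
  obtain q where q: "q \<in> gen1 x" "q \<in> L" using circle_gen1_ex1[OF L xP] by blast
  obtain u y where uy: "u \<in> E" "y \<in> E" "q = meet u y"
    using ex_coordinates[OF E circle_in_P[OF L q(2)]] .
  have "u = x"
    using uy q x E xP by (metis circle_in_P gen1_cong gen1_eq_iff meet_in(1))
  moreover have "z = y" if "z \<in> E" "meet x z \<in> L" for z
    using circle_gen1_ex1[OF L xP] q that uy x xP E \<open>u = x\<close> by (metis circle_in_P meet_eq_iff meet_in(1))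
  ultimately show ?thesis using uy q by blast
qed

lemma circle_column_ex1:
  assumes E: "E \<in> \<Lambda>" and L: "L \<in> \<Lambda>" and y: "y \<in> E"
  shows "\<exists>!x. x \<in> E \<and> meet x y \<in> L"
proof -
  have yP: "y \<in> P" using E y by (rule circle_in_P)
  obtain q where q: "q \<in> gen2 y" "q \<in> L" using circle_gen2_ex1[OF L yP] by blast
  obtain x u where uy: "x \<in> E" "u \<in> E" "q = meet x u"
    using ex_coordinates[OF E circle_in_P[OF L q(2)]] .
  have "u = y"
    using uy q y E yP by (metis circle_in_P gen2_cong gen2_eq_iff meet_in(2))
  moreover have "z = x" if "z \<in> E" "meet z y \<in> L" for z
    using circle_gen2_ex1[OF L yP] q that uy y yP E \<open>u = y\<close> by (metis circle_in_P meet_eq_iff meet_in(2))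
  ultimately show ?thesis using uy q by blast
qed

text \<open>Extended by the identity outside $E$, so that these permutations are equal as functions
  iff they agree on $E$.\<close>

definition circle_perm :: "'a set \<Rightarrow> 'a set \<Rightarrow> 'a \<Rightarrow> 'a" where
  "circle_perm E L x = (if x \<in> E then THE y. y \<in> E \<and> meet x y \<in> L else x)"

lemma circle_perm_in:
  assumes "E \<in> \<Lambda>" "L \<in> \<Lambda>" "x \<in> E"
  shows "circle_perm E L x \<in> E" "meet x (circle_perm E L x) \<in> L"
  using theI'[OF circle_row_ex1[OF assms]] assms(3) by (auto simp: circle_perm_def)

lemma circle_perm_eq_iff:
  assumes "E \<in> \<Lambda>" "L \<in> \<Lambda>" "x \<in> E" "y \<in> E"
  shows "circle_perm E L x = y \<longleftrightarrow> meet x y \<in> L"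
  using circle_perm_in[OF assms(1-3)] circle_row_ex1[OF assms(1-3)] assms(4) by blast

lemma circle_perm_permutes:
  assumes "E \<in> \<Lambda>" "L \<in> \<Lambda>"
  shows "circle_perm E L permutes E"
proof (rule bij_imp_permutes)
  show "bij_betw (circle_perm E L) E E"
    unfolding bij_betw_def
  proof
    show "inj_on (circle_perm E L) E"
      using circle_perm_in[OF assms] circle_column_ex1[OF assms] by (metis inj_onI)
    show "circle_perm E L ` E = E"
    proof
      show "E \<subseteq> circle_perm E L ` E"
        using circle_perm_eq_iff[OF assms] circle_column_ex1[OF assms] by (metis imageI subsetI)
    qed (use circle_perm_in[OF assms] in blast)
  qed
qed (simp add: circle_perm_def)

lemma circle_as_graph:
  assumes "E \<in> \<Lambda>" "L \<in> \<Lambda>"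
  shows "L = (\<lambda>x. meet x (circle_perm E L x)) ` E"
proof
  show "L \<subseteq> (\<lambda>x. meet x (circle_perm E L x)) ` E"
  proof
    fix p assume "p \<in> L"
    moreover obtain x y where "x \<in> E" "y \<in> E" "p = meet x y"
      using ex_coordinates[OF assms(1) circle_in_P[OF assms(2) \<open>p \<in> L\<close>]] .
    moreover have "circle_perm E L x = y"
      using calculation circle_perm_eq_iff[OF assms] by simp
    ultimately show "p \<in> (\<lambda>x. meet x (circle_perm E L x)) ` E" by blast
  qed
qed (use circle_perm_in[OF assms] in blast)

lemma circle_perm_inject:
  assumes "E \<in> \<Lambda>" "K \<in> \<Lambda>" "L \<in> \<Lambda>"
  shows "circle_perm E K = circle_perm E L \<longleftrightarrow> K = L"
  using circle_as_graph[OF assms(1,2)] circle_as_graph[OF assms(1,3)] by metis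

lemma circle_inter:
  assumes "E \<in> \<Lambda>" "K \<in> \<Lambda>" "L \<in> \<Lambda>"
  shows "K \<inter> L = (\<lambda>x. meet x (circle_perm E K x)) ` {x \<in> E. circle_perm E L x = circle_perm E K x}"
proof -
  have "circle_perm E L x = circle_perm E K x \<longleftrightarrow> meet x (circle_perm E K x) \<in> L" if "x \<in> E" for x
    using circle_perm_eq_iff[OF assms(1,3) that] circle_perm_in[OF assms(1,2) that] by simp
  moreover have "p \<in> K \<longleftrightarrow> (\<exists>x\<in>E. p = meet x (circle_perm E K x))" for p
    using circle_as_graph[OF assms(1,2)] by (metis (no_types, lifting) image_iff)
  ultimately show ?thesis by auto
qed

lemma ex1_circle_inter_iff:
  assumes "E \<in> \<Lambda>" "K \<in> \<Lambda>" "L \<in> \<Lambda>"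
  shows "(\<exists>!p. p \<in> K \<inter> L) \<longleftrightarrow> (\<exists>!x. x \<in> E \<and> circle_perm E L x = circle_perm E K x)"
proof -
  have ex1: "(\<exists>!y. y \<in> A) \<longleftrightarrow> is_singleton A" for A :: "'a set"
    unfolding is_singleton_def by blast
  \<comment> \<open>Injectivity preserves cardinality, and a singleton is a set of cardinality
    1.\<close>
  have "inj_on (\<lambda>x. meet x (circle_perm E K x)) {x \<in> E. circle_perm E L x = circle_perm E K x}"
    using meet_eq_iff[OF assms(1)] circle_perm_in[OF assms(1,2)] by (auto intro!: inj_onI)
  then have "(\<exists>!p. p \<in> K \<inter> L) \<longleftrightarrow> (\<exists>!x. x \<in> {x \<in> E. circle_perm E L x = circle_perm E K x})"
    unfolding circle_inter[OF assms] ex1 is_singleton_altdef by (simp add: card_image)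
  then show ?thesis by simp
qed

text \<open>The two corners spanned by these points are the points of \<open>K\<close> with first
  coordinates \<open>x\<close> and \<open>s\<close>.\<close>

lemma circle_symmetry_meet:
  assumes E: "E \<in> \<Lambda>" and K: "K \<in> \<Lambda>" and x: "x \<in> E" and s: "s \<in> E"
  shows "circle_symmetry K (meet x (circle_perm E K s)) = meet s (circle_perm E K x)"
  using circle_perm_in[OF E K] x s circle_in_P[OF E]
  by (intro circle_symmetry_eqI[OF K]) (simp_all add: meet_in_P meet_meet)

lemma orthogonal_iff_orth:
  assumes "E \<in> \<Lambda>" "K \<in> \<Lambda>" "L \<in> \<Lambda>"
  shows "orthogonal K L \<longleftrightarrow> K \<noteq> L \<and> orth (circle_perm E K) (circle_perm E L)"
proof -
  let ?f = "circle_perm E K" and ?g = "circle_perm E L"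
  have fE: "?f s \<in> E \<longleftrightarrow> s \<in> E" "?g s \<in> E \<longleftrightarrow> s \<in> E" for s
    using permutes_in_image[OF circle_perm_permutes[OF assms(1,2)]]
      permutes_in_image[OF circle_perm_permutes[OF assms(1,3)]] by auto
  have out: "?f s = s" "?g s = s" if "s \<notin> E" for s
    using that by (simp_all add: circle_perm_def)
  \<comment> \<open>As \<open>?g t = ?f s\<close>, the mirror image is \<open>meet s (?f t)\<close>.
    Surjectivity of \<open>?f\<close> supplies such an \<open>s\<close> for every
    \<open>t\<close>.\<close>
  have "circle_symmetry K (meet t (?g t)) \<in> L \<longleftrightarrow> ?f t = ?g s"
    if "s \<in> E" "t \<in> E" "?f s = ?g t" for s t
    using circle_symmetry_meet[OF assms(1,2) that(2,1)] that(3)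
      circle_perm_eq_iff[OF assms(1,3) that(1), of "?f t"] that fE by auto
  moreover have "\<exists>s\<in>E. ?f s = ?g t" if "t \<in> E" for t
    using permutes_image[OF circle_perm_permutes[OF assms(1,2)]] fE that by (metis imageE)
  ultimately have "(\<forall>t\<in>E. circle_symmetry K (meet t (?g t)) \<in> L) \<longleftrightarrow>
      (\<forall>s\<in>E. \<forall>t\<in>E. ?f s = ?g t \<longrightarrow> ?f t = ?g s)"
    by metis
  moreover have "(\<forall>p\<in>L. circle_symmetry K p \<in> L) \<longleftrightarrow>
      (\<forall>t\<in>E. circle_symmetry K (meet t (?g t)) \<in> L)"
    using circle_as_graph[OF assms(1,3)] by (metis (no_types, lifting) image_iff)
  moreover have "orth ?f ?g \<longleftrightarrow> (\<forall>s\<in>E. \<forall>t\<in>E. ?f s = ?g t \<longrightarrow> ?f t = ?g s)"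
  proof
    assume *: "\<forall>s\<in>E. \<forall>t\<in>E. ?f s = ?g t \<longrightarrow> ?f t = ?g s"
    show "orth ?f ?g"
      unfolding orth_def
    proof (intro allI impI)
      fix s t assume eq: "?f s = ?g t"
      then have iff: "s \<in> E \<longleftrightarrow> t \<in> E" using fE by metis
      show "?f t = ?g s"
      proof (cases "s \<in> E")
        case True
        then show ?thesis using * eq iff by blast
      next
        case False
        then show ?thesis using eq iff out[of s] out[of t] by metis
      qed
    qed
  qed (unfold orth_def, blast)
  ultimately have iff: "(\<forall>p\<in>L. circle_symmetry K p \<in> L) \<longleftrightarrow> orth ?f ?g" by argo
  show ?thesis unfolding orthogonal_def iff using assms(2,3) by blast
qed

end

section \<open>Symmetric Minkowski planes as sets of permutations, and the theorem\<close>

lemma (in symmetric_minkowski_plane) symmetric_permutations_circle_perm: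
  assumes E: "E \<in> \<Lambda>"
  shows "symmetric_permutations E (circle_perm E ` \<Lambda>)"
proof
  show "f permutes E" if "f \<in> circle_perm E ` \<Lambda>" for f
    using that circle_perm_permutes[OF E] by blast
  have EP: "x \<in> P" if "x \<in> E" for x using circle_in_P[OF E that] .
  have g: "gen1 (meet x y) = gen1 x" "gen2 (meet x y) = gen2 y" if "x \<in> E" "y \<in> E" for x y
    using that EP by (simp_all add: gen1_cong[OF _ meet_in(1)] gen2_cong[OF _ meet_in(2)])
  \<comment> \<open>Distinct first and distinct second coordinates are the generator conditions of
    H4.\<close>
  have K: "\<exists>!K. K \<in> \<Lambda> \<and> meet x x' \<in> K \<and> meet y y' \<in> K \<and> meet z z' \<in> K"
    if "x \<in> E" "y \<in> E" "z \<in> E" "x \<noteq> y" "y \<noteq> z" "z \<noteq> x"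
      "x' \<in> E" "y' \<in> E" "z' \<in> E" "x' \<noteq> y'" "y' \<noteq> z'" "z' \<noteq> x'"
    for x y z x' y' z'
    using that by (intro H4)
      (auto simp: g gen1_eq_iff[OF E] gen2_eq_iff[OF E] meet_eq_iff[OF E] EP intro!: meet_in_P)
  show "\<exists>f\<in>circle_perm E ` \<Lambda>. f x = x' \<and> f y = y' \<and> f z = z'"
    if "x \<in> E" "y \<in> E" "z \<in> E" "x \<noteq> y" "y \<noteq> z" "z \<noteq> x"
      "x' \<in> E" "y' \<in> E" "z' \<in> E" "x' \<noteq> y'" "y' \<noteq> z'" "z' \<noteq> x'"
    for x y z x' y' z'
    using K[OF that] that circle_perm_eq_iff[OF E] by blast
  show "f = g" if fg: "f \<in> circle_perm E ` \<Lambda>" "g \<in> circle_perm E ` \<Lambda>"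
    and xyz: "x \<in> E" "y \<in> E" "z \<in> E" "x \<noteq> y" "y \<noteq> z" "z \<noteq> x" and eq: "f x = g x" "f y = g y" "f z = g z"
    for f g x y z
  proof -
    obtain L M where LM: "L \<in> \<Lambda>" "M \<in> \<Lambda>" "f = circle_perm E L" "g = circle_perm E M" using fg by blast
    have "g x \<in> E" "g y \<in> E" "g z \<in> E" using circle_perm_in(1)[OF E LM(2)] LM xyz by auto
    moreover have "g x \<noteq> g y" "g y \<noteq> g z" "g z \<noteq> g x"
      using permutes_inj[OF circle_perm_permutes[OF E LM(2)]] LM xyz by (auto simp: inj_eq)
    ultimately have "L = M"
      using K[of x y z "g x" "g y" "g z"] xyz eq LM circle_perm_in(2)[OF E] by metis
    with LM show ?thesis by simp
  qed
  show "orth f g" if fg: "f \<in> circle_perm E ` \<Lambda>" "g \<in> circle_perm E ` \<Lambda>"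
    and uv: "u \<in> E" "v \<in> E" "u \<noteq> v" "f u = g v" "f v = g u" for f g u v
  proof -
    obtain L M where LM: "L \<in> \<Lambda>" "M \<in> \<Lambda>" "f = circle_perm E L" "g = circle_perm E M" using fg by blast
    have inj: "inj f" using permutes_inj[OF circle_perm_permutes[OF E LM(1)]] LM by simp
    have gE: "g u \<in> E" using circle_perm_in(1)[OF E LM(2)] LM uv by simp
    \<comment> \<open>The point of \<open>M\<close> over \<open>u\<close> is off \<open>L\<close>,
      and the symmetry in \<open>L\<close> sends it to the point of \<open>M\<close> over
      \<open>v\<close>, so the symmetry axiom applies.\<close>
    have "f u \<noteq> g u" using uv inj by (metis injD)
    then have "meet u (g u) \<in> M - L"
      using circle_perm_in(2)[OF E LM(2) uv(1)] circle_perm_eq_iff[OF E LM(1) uv(1) gE] LM by simp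
    moreover have "circle_symmetry L (meet u (g u)) = meet v (g v)"
      using circle_symmetry_meet[OF E LM(1) uv(1,2)] uv LM by simp
    moreover have "meet v (g v) \<in> M" using circle_perm_in(2)[OF E LM(2) uv(2)] LM by simp
    ultimately have "orthogonal L M" using symmetry_axiom LM by metis
    then show ?thesis using orthogonal_iff_orth[OF E LM(1,2)] LM by simp
  qed
  obtain L a b c where abc: "L \<in> \<Lambda>" "a \<in> L" "b \<in> L" "c \<in> L" "a \<noteq> b" "b \<noteq> c" "c \<noteq> a"
    using H5 by blast
  \<comment> \<open>Projection along the generators of \<open>\<Sigma>1\<close> carries the three
    points of \<open>L\<close> to three points of \<open>E\<close>.\<close>
  have "\<exists>x\<in>E. gen1 x = gen1 p" if "p \<in> L" for p
    using circle_gen1_ex1[OF E circle_in_P[OF abc(1) that]] gen1_cong circle_in_P[OF abc(1) that]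
    by metis
  then show "\<exists>x\<in>E. \<exists>y\<in>E. \<exists>z\<in>E. x \<noteq> y \<and> y \<noteq> z \<and> z \<noteq> x"
    using abc gen1_eq_iff[OF abc(1)] by metis
qed

theorem theorem3p1:
  fixes P :: "'a set" and \<Lambda> \<Sigma>1 \<Sigma>2 :: "'a set set"
  assumes "symmetric_minkowski_plane P \<Lambda> \<Sigma>1 \<Sigma>2"
    and "\<exists>K\<in>\<Lambda>. \<exists>L\<in>\<Lambda>. hyperbola_structure.orthogonal P \<Lambda> \<Sigma>1 \<Sigma>2 K L \<and> (\<exists>!p. p \<in> K \<inter> L)"
  shows "(\<forall>K\<in>\<Lambda>. \<forall>L\<in>\<Lambda>. K \<noteq> L \<longrightarrow> (\<exists>!p. p \<in> K \<inter> L) \<longrightarrow>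
            hyperbola_structure.orthogonal P \<Lambda> \<Sigma>1 \<Sigma>2 K L) \<and>
         (\<forall>K\<in>\<Lambda>. \<forall>L\<in>\<Lambda>. hyperbola_structure.orthogonal P \<Lambda> \<Sigma>1 \<Sigma>2 K L \<longrightarrow>
            (\<exists>\<^sub>\<le>\<^sub>1p. p \<in> K \<inter> L))"
proof -
  interpret symmetric_minkowski_plane P \<Lambda> \<Sigma>1 \<Sigma>2 by (rule assms(1))
  \<comment> \<open>The coordinate circle is chosen from the given touching orthogonal pair, which
    becomes \<open>circle_perm E E\<close> and \<open>circle_perm E M\<close>.\<close>
  obtain E M where E: "E \<in> \<Lambda>" and M: "M \<in> \<Lambda>" "orthogonal E M" "\<exists>!p. p \<in> E \<inter> M"
    using assms(2) by blast
  interpret S: symmetric_permutations E "circle_perm E ` \<Lambda>"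
    by (rule symmetric_permutations_circle_perm[OF E])
  have le1: "orth_common_le1 E (circle_perm E ` \<Lambda>) (circle_perm E K)" if K: "K \<in> \<Lambda>" for K
  proof (rule S.orth_common_le1_all)
    show "orth (circle_perm E E) (circle_perm E M)" using orthogonal_iff_orth[OF E E M(1)] M(2) by simp
    show "\<exists>!p. p \<in> E \<and> circle_perm E M p = circle_perm E E p"
      using ex1_circle_inter_iff[OF E E M(1)] M(3) by simp
  qed (use E M K in auto)
  show ?thesis
  proof (intro conjI ballI impI)
    fix K L assume KL: "K \<in> \<Lambda>" "L \<in> \<Lambda>" "K \<noteq> L" and "\<exists>!p. p \<in> K \<inter> L"
    then have "\<exists>!x. x \<in> E \<and> circle_perm E L x = circle_perm E K x"
      using ex1_circle_inter_iff[OF E KL(1,2)] by simp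
    then have "orth (circle_perm E K) (circle_perm E L)"
      using S.orth_if_common_unique[OF _ le1[OF KL(1)]] KL by blast
    then show "orthogonal K L" using orthogonal_iff_orth[OF E KL(1,2)] KL by simp
  next
    fix K L assume KL: "K \<in> \<Lambda>" "L \<in> \<Lambda>" "orthogonal K L"
    then have "orth (circle_perm E K) (circle_perm E L)" "circle_perm E K \<noteq> circle_perm E L"
      using orthogonal_iff_orth[OF E KL(1,2)] circle_perm_inject[OF E KL(1,2)] by auto
    then have "x = y" if "x \<in> E" "y \<in> E" "circle_perm E L x = circle_perm E K x"
      "circle_perm E L y = circle_perm E K y" for x y
      using le1[OF KL(1)] KL that unfolding orth_common_le1_def by (metis imageI)
    then show "\<exists>\<^sub>\<le>\<^sub>1p. p \<in> K \<inter> L"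
      unfolding circle_inter[OF E KL(1,2)] Uniq_def by blast
  qed
qed

end
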